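(* Let $\mathcal{X}$ be a proper geodesic metric space, $\mathcal{A}\subset\mathcal{X}$ a (nonempty) subset, and $\pi\colon\mathcal{X}\to\mathcal{A}$ a coarse map. The following are equivalent: (1) $\pi$ is strongly constricting. (2) $\pi$ is constricting for some minimizing path system. (3) $\pi$ is strongly contracting. (4) $\pi$ has the Bounded Geodesic Image Property and $d(x,\pi(x))-d(x,\mathcal{A})$ is uniformly bounded over $x\in\mathcal{X}$.
   Context: A $C$-coarse map $\pi\colon\mathcal{X}\to\mathcal{A}$ assigns to each point of $\mathcal{X}$ a (nonempty) subset of $\mathcal{A}$ of diameter at most $C$; a coarse map is a $C$-coarse map for some $C\geqslant0$. Two such maps $\phi,\phi'$ are $C$-coarsely equivalent if $\phi(x)$ and $\phi'(x)$ lie in the closed $C$-neighborhoods of each other for all $x$ in the domain. Write $d^\pi(x_0,x_1):=\operatorname{diam}(\pi(x_0)\cup\pi(x_1))$; distances between sets are infima. Strongly contracting: there is $C\geqslant0$ such that $\pi$ and $\mathrm{Id}_{\mathcal{A}}$ are $C$-coarsely equivalent on $\mathcal{A}$; $d(x_0,x_1)<d(x_0,\mathcal{A})-C$ implies $d^\pi(x_0,x_1)\leqslant C$ for all $x_0,x_1\in\mathcal{X}$; and $d(x,\pi(x))-d(x,\mathcal{A})\leqslant C$ for all $x\in\mathcal{X}$. Bounded Geodesic Image Property: there is a constant $C$ such that for every geodesic $\mathcal{L}$, if $\mathcal{L}$ is disjoint from the open $C$-neighborhood of $\mathcal{A}$ then $\operatorname{diam}(\pi(\mathcal{L}))\leqslant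 C$. An $(M,C)$-quasi-geodesic is an $(M,C)$-quasi-isometric embedding (i.e. $\frac1M|s-t|-C\leqslant d(\gamma(s),\gamma(t))\leqslant M|s-t|+C$) of a coarsely connected subset of $\mathbb{R}$ into $\mathcal{X}$. A path system is a transitive collection of quasi-geodesics with uniform constants (transitive: every pair of points of $\mathcal{X}$ is joined by a member) that is closed under taking subpaths. A path system is minimizing if, for some $C\geqslant0$, it contains a path system consisting of $(1,C)$-quasi-geodesics. Constricting: for a path system $\mathcal{PS}$, $\pi$ is $(M,C)$-$\mathcal{PS}$-constricting ($M\geqslant1$, $C\geqslant0$) if $\mathcal{PS}$ contains a path system consisting of $(M,C)$-quasi-geodesics; $\pi$ and $\mathrm{Id}_{\mathcal{A}}$ are $C$-coarsely equivalent on $\mathcal{A}$; and for every $\mathcal{P}\in\mathcal{PS}$ with endpoints $x_0,x_1$, if $d^\pi(x_0,x_1)>C$ then $d(\pi(x_i),\mathcal{P})\leqslant C$ for both $i\in\{0,1\}$. $\pi$ is constricting for $\mathcal{PS}$ if it is $(M,C)$-$\mathcal{PS}$-constricting for some $M,C$. $\pi$ is strongly constricting if it is $(1,C)$-$\mathcal{PS}$-constricting for some $C$, where $\mathcal{PS}$ is the path system consisting of all geodesics. *)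

theory Defs
  imports "HOL-Analysis.Analysis"
begin

section \<open>Diameters and neighborhoods\<close>

text \<open>The library's \<open>diameter\<close> is real-valued and carries no information on unbounded sets,
  so a bound on the diameter has to include boundedness.\<close>

definition diam_le :: "'a::metric_space set \<Rightarrow> real \<Rightarrow> bool" where
  "diam_le S C \<longleftrightarrow> bounded S \<and> diameter S \<le> C"

definition closed_nbhd :: "real \<Rightarrow> 'a::metric_space set \<Rightarrow> 'a set" where
  "closed_nbhd C S = {y. infdist y S \<le> C}"

definition open_nbhd :: "real \<Rightarrow> 'a::metric_space set \<Rightarrow> 'a set" where
  "open_nbhd C S = {y. infdist y S < C}"

section \<open>Coarse maps\<close>

definition C_coarse_map :: "real \<Rightarrow> ('a \<Rightarrow> 'b::metric_space set) \<Rightarrow> 'b set \<Rightarrow> bool" where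
  "C_coarse_map C \<pi> A \<longleftrightarrow> (\<forall>x. \<pi> x \<noteq> {} \<and> \<pi> x \<subseteq> A \<and> diam_le (\<pi> x) C)"

definition coarse_map :: "('a \<Rightarrow> 'b::metric_space set) \<Rightarrow> 'b set \<Rightarrow> bool" where
  "coarse_map \<pi> A \<longleftrightarrow> (\<exists>C\<ge>0. C_coarse_map C \<pi> A)"

definition coarsely_equivalent_on ::
    "real \<Rightarrow> 'a set \<Rightarrow> ('a \<Rightarrow> 'b::metric_space set) \<Rightarrow> ('a \<Rightarrow> 'b set) \<Rightarrow> bool" where
  "coarsely_equivalent_on C D \<phi> \<phi>' \<longleftrightarrow>
     (\<forall>x\<in>D. \<phi> x \<subseteq> closed_nbhd C (\<phi>' x) \<and> \<phi>' x \<subseteq> closed_nbhd C (\<phi> x))"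

text \<open>Used only for coarse maps, where both sets are bounded and the diameter is meaningful.\<close>

definition dproj :: "('a \<Rightarrow> 'b::metric_space set) \<Rightarrow> 'a \<Rightarrow> 'a \<Rightarrow> real" where
  "dproj \<pi> x0 x1 = diameter (\<pi> x0 \<union> \<pi> x1)"

section \<open>Geodesics and quasi-geodesics\<close>

text \<open>A map from a set \<open>I\<close> of reals is encoded as a pair of \<open>I\<close> and a total function whose
  values outside \<open>I\<close> are irrelevant: everything below depends only on the restriction to \<open>I\<close>.\<close>

type_synonym 'a rpath = "real set \<times> (real \<Rightarrow> 'a)"

definition trace :: "'a rpath \<Rightarrow> 'a set" where
  "trace P = snd P ` fst P"

text \<open>Only a path whose domain has a least and a greatest element has endpoints; they are taken
  without order.\<close>

definition has_endpoints :: "'a rpath \<Rightarrow> 'a \<Rightarrow> 'a \<Rightarrow> bool" where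
  "has_endpoints P x0 x1 \<longleftrightarrow>
     (\<exists>a\<in>fst P. \<exists>b\<in>fst P. fst P \<subseteq> {a..b} \<and> {snd P a, snd P b} = {x0, x1})"

definition geodesic :: "'a::metric_space rpath \<Rightarrow> bool" where
  "geodesic P \<longleftrightarrow> fst P \<noteq> {} \<and> is_interval (fst P) \<and>
     (\<forall>s\<in>fst P. \<forall>t\<in>fst P. dist (snd P s) (snd P t) = \<bar>s - t\<bar>)"

definition coarsely_connected :: "'a::metric_space set \<Rightarrow> bool" where
  "coarsely_connected S \<longleftrightarrow>
     (\<exists>c. \<forall>x\<in>S. \<forall>y\<in>S. (\<lambda>u v. u \<in> S \<and> v \<in> S \<and> dist u v \<le> c)\<^sup>*\<^sup>* x y)"

definition quasi_geodesic :: "real \<Rightarrow> real \<Rightarrow> 'a::metric_space rpath \<Rightarrow> bool" where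
  "quasi_geodesic M C P \<longleftrightarrow> fst P \<noteq> {} \<and> coarsely_connected (fst P) \<and>
     (\<forall>s\<in>fst P. \<forall>t\<in>fst P.
        1 / M * \<bar>s - t\<bar> - C \<le> dist (snd P s) (snd P t) \<and>
        dist (snd P s) (snd P t) \<le> M * \<bar>s - t\<bar> + C)"

text \<open>A subpath is the restriction to the part of the domain lying in an interval; empty
  restrictions do not count.\<close>

definition subpath_of :: "'a rpath \<Rightarrow> 'a rpath \<Rightarrow> bool" where
  "subpath_of Q P \<longleftrightarrow>
     (\<exists>J. is_interval J \<and> fst P \<inter> J \<noteq> {} \<and> Q = (fst P \<inter> J, snd P))"

section \<open>Path systems\<close>

definition path_system :: "'a::metric_space rpath set \<Rightarrow> bool" where
  "path_system PS \<longleftrightarrow>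
     (\<exists>M\<ge>1. \<exists>C\<ge>0. \<forall>P\<in>PS. quasi_geodesic M C P) \<and>
     (\<forall>x y. \<exists>P\<in>PS. has_endpoints P x y) \<and>
     (\<forall>P\<in>PS. \<forall>Q. subpath_of Q P \<longrightarrow> Q \<in> PS)"

definition contains_path_system :: "'a::metric_space rpath set \<Rightarrow> real \<Rightarrow> real \<Rightarrow> bool" where
  "contains_path_system PS M C \<longleftrightarrow>
     (\<exists>PS'\<subseteq>PS. path_system PS' \<and> (\<forall>P\<in>PS'. quasi_geodesic M C P))"

definition minimizing :: "'a::metric_space rpath set \<Rightarrow> bool" where
  "minimizing PS \<longleftrightarrow> (\<exists>C\<ge>0. contains_path_system PS 1 C)"

section \<open>Constricting and contracting maps\<close>

definition MC_constricting ::
    "real \<Rightarrow> real \<Rightarrow> 'a::metric_space rpath set \<Rightarrow> 'a set \<Rightarrow> ('a \<Rightarrow> 'a set) \<Rightarrow> bool" where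
  "MC_constricting M C PS A \<pi> \<longleftrightarrow> M \<ge> 1 \<and> C \<ge> 0 \<and>
     contains_path_system PS M C \<and>
     coarsely_equivalent_on C A \<pi> (\<lambda>x. {x}) \<and>
     (\<forall>P\<in>PS. \<forall>x0 x1. has_endpoints P x0 x1 \<longrightarrow> dproj \<pi> x0 x1 > C \<longrightarrow>
        setdist (\<pi> x0) (trace P) \<le> C \<and> setdist (\<pi> x1) (trace P) \<le> C)"

definition constricting ::
    "'a::metric_space rpath set \<Rightarrow> 'a set \<Rightarrow> ('a \<Rightarrow> 'a set) \<Rightarrow> bool" where
  "constricting PS A \<pi> \<longleftrightarrow> (\<exists>M C. MC_constricting M C PS A \<pi>)"

definition strongly_constricting :: "'a::metric_space set \<Rightarrow> ('a \<Rightarrow> 'a set) \<Rightarrow> bool" where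
  "strongly_constricting A \<pi> \<longleftrightarrow> (\<exists>C. MC_constricting 1 C {P. geodesic P} A \<pi>)"

definition strongly_contracting :: "'a::metric_space set \<Rightarrow> ('a \<Rightarrow> 'a set) \<Rightarrow> bool" where
  "strongly_contracting A \<pi> \<longleftrightarrow> (\<exists>C\<ge>0.
     coarsely_equivalent_on C A \<pi> (\<lambda>x. {x}) \<and>
     (\<forall>x0 x1. dist x0 x1 < infdist x0 A - C \<longrightarrow> dproj \<pi> x0 x1 \<le> C) \<and>
     (\<forall>x. infdist x (\<pi> x) - infdist x A \<le> C))"

definition bounded_geodesic_image :: "'a::metric_space set \<Rightarrow> ('a \<Rightarrow> 'a set) \<Rightarrow> bool" where
  "bounded_geodesic_image A \<pi> \<longleftrightarrow> (\<exists>C. \<forall>L. geodesic L \<longrightarrow>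
     trace L \<inter> open_nbhd C A = {} \<longrightarrow> diam_le (\<Union>x\<in>trace L. \<pi> x) C)"

end

theory Submission
  imports Defs
begin

text \<open>The cycle is (1) \<open>\<Longrightarrow>\<close> (2) \<open>\<Longrightarrow>\<close> (3) \<open>\<Longrightarrow>\<close> (4) \<open>\<Longrightarrow>\<close> (1).
  (2) \<open>\<Longrightarrow>\<close> (3): a path from \<open>x0\<close> to \<open>x1\<close> that is geodesic up to an additive error stays within about
  \<open>d(x0,x1)\<close> of \<open>x0\<close>, so it cannot come close to \<open>A\<close> if \<open>d(x0,x1)\<close> is smaller than the distance from
  \<open>x0\<close> to \<open>A\<close>; hence \<open>\<pi>\<close> barely moves.
  (3) \<open>\<Longrightarrow>\<close> (4): cover a geodesic segment far from \<open>A\<close> by one contracted ball about each endpoint and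
  by steps of length \<open>2C\<close> on the remaining middle part of length \<open>m\<close>; the projection moves by at most
  \<open>m/2 + O(C)\<close>.  The detour through the projections of the endpoints is no shorter than the segment,
  so the projection moves by at least \<open>m - O(C)\<close>, and \<open>m\<close> is bounded.
  (4) \<open>\<Longrightarrow>\<close> (1): go from an endpoint to the first point that is close to \<open>A\<close>.\<close>

section \<open>Projection distances\<close>

text \<open>The infimum need not be attained, so extracting a point costs strict slack; this
  explains the extra \<open>1\<close>, \<open>C\<close>, \<open>d\<close> or
  \<open>\<epsilon>\<close> in later estimates.\<close>

lemma infdist_ltE:
  assumes "infdist x S < b" "S \<noteq> {}"
  obtains y where "y \<in> S" "dist x y < b"
  using assms setdist_ltE[of "{x}" S b] by (auto simp: infdist_eq_setdist)

lemma diam_leI: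
  assumes "S \<noteq> {}" and le: "\<And>p q. \<lbrakk>p \<in> S; q \<in> S\<rbrakk> \<Longrightarrow> dist p q \<le> d"
  shows "diam_le S d"
proof -
  have "bounded S"
    using assms unfolding bounded_def by blast
  moreover have "diameter S \<le> d"
    using assms by (auto simp: diameter_def intro: cSUP_least)
  ultimately show ?thesis
    by (simp add: diam_le_def)
qed

lemma dist_le_diam_le: "\<lbrakk>diam_le S d; p \<in> S; q \<in> S\<rbrakk> \<Longrightarrow> dist p q \<le> d"
  unfolding diam_le_def by (meson diameter_bounded_bound order_trans)

lemma coarse_map_nonempty: "coarse_map \<pi> A \<Longrightarrow> \<pi> x \<noteq> {}"
  and coarse_map_subset: "coarse_map \<pi> A \<Longrightarrow> \<pi> x \<subseteq> A"
  and coarse_map_bounded: "coarse_map \<pi> A \<Longrightarrow> bounded (\<pi> x)"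
  unfolding coarse_map_def C_coarse_map_def diam_le_def by auto

lemma dist_le_dproj:
  assumes "coarse_map \<pi> A" "p \<in> \<pi> x \<union> \<pi> y" "q \<in> \<pi> x \<union> \<pi> y"
  shows "dist p q \<le> dproj \<pi> x y"
  unfolding dproj_def using assms
  by (intro diameter_bounded_bound) (auto intro: coarse_map_bounded)

lemma dproj_leI:
  assumes "coarse_map \<pi> A"
    and "\<And>p q. \<lbrakk>p \<in> \<pi> x \<union> \<pi> y; q \<in> \<pi> x \<union> \<pi> y\<rbrakk> \<Longrightarrow> dist p q \<le> d"
  shows "dproj \<pi> x y \<le> d"
  using diam_leI[of "\<pi> x \<union> \<pi> y" d] assms coarse_map_nonempty[OF assms(1), of x]
  by (auto simp: dproj_def diam_le_def)

lemma dproj_commute: "dproj \<pi> x y = dproj \<pi> y x"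
  by (simp add: dproj_def Un_commute)

text \<open>A point \<open>r\<close> of the nonempty set \<open>\<pi> y\<close> serves as stopover;
  two points of the same projection are already controlled by one summand.\<close>

lemma dproj_triangle:
  assumes "coarse_map \<pi> A"
  shows "dproj \<pi> x z \<le> dproj \<pi> x y + dproj \<pi> y z"
proof (rule dproj_leI[OF assms])
  fix p q assume pq: "p \<in> \<pi> x \<union> \<pi> z" "q \<in> \<pi> x \<union> \<pi> z"
  obtain r where r: "r \<in> \<pi> y"
    using coarse_map_nonempty[OF assms] by blast
  have d: "dist u v \<le> dproj \<pi> a b"
    if "u \<in> \<pi> a \<union> \<pi> b" "v \<in> \<pi> a \<union> \<pi> b" for u v a b
    using that dist_le_dproj[OF assms] by blast
  have nn: "0 \<le> dproj \<pi> x y" "0 \<le> dproj \<pi> y z"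
    using d[of r x y r] d[of r y z r] r by auto
  consider "p \<in> \<pi> x" "q \<in> \<pi> x" | "p \<in> \<pi> z" "q \<in> \<pi> z"
    | "p \<in> \<pi> x" "q \<in> \<pi> z" | "p \<in> \<pi> z" "q \<in> \<pi> x"
    using pq by blast
  then show "dist p q \<le> dproj \<pi> x y + dproj \<pi> y z"
  proof cases
    case 1
    then show ?thesis using d[of p x y q] nn by auto
  next
    case 2
    then show ?thesis using d[of p y z q] nn by auto
  next
    case 3
    then show ?thesis
      using d[of p x y r] d[of r y z q] r dist_triangle[of p q r] by auto
  next
    case 4
    then show ?thesis
      using d[of p y z r] d[of r x y q] r dist_triangle[of p q r] by auto
  qed
qed

lemma coarsely_equivalent_on_mono:
  "\<lbrakk>coarsely_equivalent_on C D \<phi> \<psi>; C \<le> C'\<rbrakk> \<Longrightarrow> coarsely_equivalent_on C' D \<phi> \<psi>"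
  unfolding coarsely_equivalent_on_def closed_nbhd_def by fastforce

section \<open>Geodesics form a path system\<close>

lemma is_interval_coarsely_connected:
  fixes S :: "real set"
  assumes "is_interval S"
  shows "coarsely_connected S"
  unfolding coarsely_connected_def
proof (intro exI ballI)
  let ?R = "\<lambda>u v. u \<in> S \<and> v \<in> S \<and> dist u v \<le> 1"
  have "?R\<^sup>*\<^sup>* x y" if "x \<in> S" "y \<in> S" "\<bar>x - y\<bar> \<le> real n" for x y n
    using that
  proof (induction n arbitrary: x)
    case 0
    then show ?case by auto
  next
    case (Suc n)
    \<comment> \<open>Move one unit towards \<open>y\<close>, or to \<open>y\<close> itself once it
      is within reach; \<open>z\<close> lies between \<open>x\<close> and \<open>y\<close>, hence in
      the interval.\<close>
    define z where "z = (if \<bar>x - y\<bar> \<le> 1 then y else if x < y then x + 1 else x - 1)"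
    have "x \<le> z \<and> z \<le> y \<or> y \<le> z \<and> z \<le> x"
      by (auto simp: z_def)
    then have "z \<in> S"
      using assms Suc.prems unfolding is_interval_1 by blast
    moreover have "dist x z \<le> 1" "\<bar>z - y\<bar> \<le> real n"
      using Suc.prems by (auto simp: z_def dist_real_def)
    ultimately show ?case
      using Suc.IH[of z] Suc.prems by (auto intro: converse_rtranclp_into_rtranclp)
  qed
  then show "?R\<^sup>*\<^sup>* x y" if "x \<in> S" "y \<in> S" for x y
    using that real_arch_simple[of "\<bar>x - y\<bar>"] by blast
qed

lemma geodesic_quasi_geodesic: "\<lbrakk>geodesic P; 0 \<le> C\<rbrakk> \<Longrightarrow> quasi_geodesic 1 C P"
  by (auto simp: geodesic_def quasi_geodesic_def is_interval_coarsely_connected)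

lemma geodesic_subpath: "\<lbrakk>geodesic P; subpath_of Q P\<rbrakk> \<Longrightarrow> geodesic Q"
  unfolding geodesic_def subpath_of_def by (auto intro: is_interval_Int)

lemma path_system_geodesics:
  assumes "\<And>x y :: 'a::metric_space. \<exists>P. geodesic P \<and> has_endpoints P x y"
  shows "path_system {P :: 'a rpath. geodesic P}"
  unfolding path_system_def
  using assms geodesic_quasi_geodesic geodesic_subpath by blast

lemma contains_path_system_geodesics:
  assumes "\<And>x y :: 'a::metric_space. \<exists>P. geodesic P \<and> has_endpoints P x y" and "0 \<le> C"
  shows "contains_path_system {P :: 'a rpath. geodesic P} 1 C"
  unfolding contains_path_system_def
  using path_system_geodesics[OF assms(1)] geodesic_quasi_geodesic[OF _ assms(2)] by blast

text \<open>The path system of all geodesics is the witness.\<close>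

lemma strongly_constricting_imp_minimizing:
  fixes A :: "'a::metric_space set"
  assumes "\<And>x y :: 'a. \<exists>P. geodesic P \<and> has_endpoints P x y"
    and "strongly_constricting A \<pi>"
  shows "\<exists>PS. path_system PS \<and> minimizing PS \<and> constricting PS A \<pi>"
  using assms path_system_geodesics[OF assms(1)] contains_path_system_geodesics[OF assms(1)]
  unfolding strongly_constricting_def constricting_def minimizing_def by blast

section \<open>Constricting maps are contracting\<close>

text \<open>With multiplicative constant 1 the domain has length at most
  \<open>dist x0 x1 + C\<close>, so every point of the path is within
  \<open>dist x0 x1 + 2 * C\<close> of either endpoint.\<close>

lemma quasi_geodesic_dist_endpoint_le:
  assumes "quasi_geodesic 1 C P" "has_endpoints P x0 x1" "z \<in> trace P"
  shows "dist x0 z \<le> dist x0 x1 + 3 * C"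
proof -
  obtain a b where ab: "a \<in> fst P" "b \<in> fst P" "fst P \<subseteq> {a..b}"
      "{snd P a, snd P b} = {x0, x1}"
    using assms(2) unfolding has_endpoints_def by blast
  obtain t where t: "t \<in> fst P" "z = snd P t"
    using assms(3) unfolding trace_def by blast
  have q: "\<bar>s - u\<bar> - C \<le> dist (snd P s) (snd P u)" "dist (snd P s) (snd P u) \<le> \<bar>s - u\<bar> + C"
    if "s \<in> fst P" "u \<in> fst P" for s u
    using assms(1) that unfolding quasi_geodesic_def by auto
  have "0 \<le> C"
    using q(2)[of a a] ab by simp
  have t': "a \<le> t" "t \<le> b"
    using ab t by auto
  have "dist x0 x1 = dist (snd P a) (snd P b)"
    using ab(4) by (auto simp: doubleton_eq_iff dist_commute)
  moreover have "x0 = snd P a \<or> x0 = snd P b"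
    using ab(4) by auto
  ultimately show ?thesis
    using q[of a b] q[of a t] q[of b t] ab t t' \<open>0 \<le> C\<close> by auto
qed

lemma minimizing_constricting_imp_strongly_contracting:
  assumes coarse: "coarse_map \<pi> A" and "A \<noteq> {}"
    and min: "minimizing PS" and con: "constricting PS A \<pi>"
  shows "strongly_contracting A \<pi>"
proof -
  obtain C1 PS' where C1: "PS' \<subseteq> PS" "path_system PS'" "\<And>P. P \<in> PS' \<Longrightarrow> quasi_geodesic 1 C1 P"
    using min unfolding minimizing_def contains_path_system_def by blast
  obtain M C2 where C2: "C2 \<ge> 0" "coarsely_equivalent_on C2 A \<pi> (\<lambda>x. {x})"
    and C2': "\<And>P x0 x1. \<lbrakk>P \<in> PS; has_endpoints P x0 x1; dproj \<pi> x0 x1 > C2\<rbrakk> \<Longrightarrow>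
        setdist (\<pi> x0) (trace P) \<le> C2"
    using con unfolding constricting_def MC_constricting_def by blast
  define C where "C = max C1 C2"
  have C: "C \<ge> 0" "C1 \<le> C" "C2 \<le> C"
    using C2 by (auto simp: C_def)
  \<comment> \<open>Constriction applies to a path from \<open>PS'\<close>, since
    \<open>PS' \<subseteq> PS\<close>. Some \<open>z\<close> on it is within \<open>C + 1\<close> of
    \<open>\<pi> x0\<close> and within \<open>dist x0 x1 + 3 * C\<close> of \<open>x0\<close>; the
    sum gives \<open>4 * C + 1\<close>.\<close>
  have key: "\<exists>y\<in>\<pi> x0. dist x0 y \<le> dist x0 x1 + 4 * C + 1" if big: "dproj \<pi> x0 x1 > C" for x0 x1
  proof -
    obtain P where P: "P \<in> PS'" "has_endpoints P x0 x1"
      using C1(2) unfolding path_system_def by blast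
    have ne: "trace P \<noteq> {}"
      using P(2) unfolding has_endpoints_def trace_def by blast
    have "setdist (\<pi> x0) (trace P) < C + 1"
      using C2'[of P x0 x1] P C1(1) big C by auto
    then obtain y z where yz: "y \<in> \<pi> x0" "z \<in> trace P" "dist y z < C + 1"
      using setdist_ltE ne coarse_map_nonempty[OF coarse] by metis
    have "dist x0 z \<le> dist x0 x1 + 3 * C"
      using quasi_geodesic_dist_endpoint_le[OF C1(3)[OF P(1)] P(2) yz(2)] C by simp
    then show ?thesis
      using yz dist_triangle[of x0 y z] by (auto simp: dist_commute intro!: bexI[of _ y])
  qed
  \<comment> \<open>Compare \<open>x\<close> with an almost nearest point \<open>p\<close> of
    \<open>A\<close>. If the projections are far apart, \<open>key\<close> applies; otherwise
    \<open>\<pi> x\<close> is close to \<open>\<pi> p\<close>, which has a point close to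
    \<open>p\<close> because \<open>p \<in> A\<close>.\<close>
  have proj: "infdist x (\<pi> x) - infdist x A \<le> 4 * C + 2" for x
  proof -
    obtain p where p: "p \<in> A" "dist x p < infdist x A + 1"
      using infdist_ltE[of x A "infdist x A + 1"] \<open>A \<noteq> {}\<close> by auto
    have "\<exists>y\<in>\<pi> x. dist x y \<le> dist x p + 4 * C + 1"
    proof (cases "dproj \<pi> x p > C")
      case True
      then show ?thesis by (rule key)
    next
      case False
      have "infdist p (\<pi> p) < C + 1"
        using C2(2) p(1) C unfolding coarsely_equivalent_on_def closed_nbhd_def by force
      then obtain q where q: "q \<in> \<pi> p" "dist p q < C + 1"
        using infdist_ltE coarse_map_nonempty[OF coarse] by metis
      obtain y where y: "y \<in> \<pi> x"
        using coarse_map_nonempty[OF coarse] by blast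
      have "dist q y \<le> C"
        using dist_le_dproj[OF coarse, of q x p y] q y False by auto
      then show ?thesis
        using y q C dist_triangle[of x y p] dist_triangle[of p y q]
        by (auto intro!: bexI[of _ y])
    qed
    then obtain y where "y \<in> \<pi> x" "dist x y \<le> dist x p + 4 * C + 1"
      by blast
    then show ?thesis
      using p infdist_le[of y "\<pi> x" x] by linarith
  qed
  \<comment> \<open>If the projections were further apart, \<open>key\<close> would give a point of
    \<open>\<pi> x0\<close>, hence of \<open>A\<close>, closer to \<open>x0\<close> than
    \<open>infdist x0 A\<close>.\<close>
  have contr: "dproj \<pi> x0 x1 \<le> 4 * C + 2" if "dist x0 x1 < infdist x0 A - (4 * C + 2)" for x0 x1
  proof (rule ccontr)
    assume "\<not> ?thesis"
    then obtain y where y: "y \<in> \<pi> x0" "dist x0 y \<le> dist x0 x1 + 4 * C + 1"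
      using key[of x0 x1] C by fastforce
    moreover have "infdist x0 A \<le> dist x0 y"
      using y coarse_map_subset[OF coarse] by (blast intro: infdist_le)
    ultimately show False
      using that by linarith
  qed
  show ?thesis
    unfolding strongly_contracting_def
  proof (intro exI conjI)
    show "coarsely_equivalent_on (4 * C + 2) A \<pi> (\<lambda>x. {x})"
      using C2(2) coarsely_equivalent_on_mono C by force
  qed (use C contr proj in auto)
qed

section \<open>Contracting maps have bounded geodesic images\<close>

text \<open>At distance at least \<open>4 * C\<close> from \<open>A\<close>, a step of length
  \<open>2 * C\<close> is short enough for \<open>contr\<close> and moves the projection by at most
  \<open>C\<close>. The resulting rate 1/2 is below 1, which is what later bounds the middle
  part.\<close>

lemma dproj_chain:
  assumes coarse: "coarse_map \<pi> A" and "C > 0"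
    and contr: "\<And>x y. dist x y < infdist x A - C \<Longrightarrow> dproj \<pi> x y \<le> C"
    and geo: "geodesic L" and I: "{s..t} \<subseteq> fst L" and "s \<le> t"
    and far: "\<And>u. u \<in> {s..t} \<Longrightarrow> 4 * C \<le> infdist (snd L u) A"
  shows "dproj \<pi> (snd L s) (snd L t) \<le> (t - s) / 2 + 2 * C"
proof -
  have g: "dist (snd L u) (snd L v) = \<bar>u - v\<bar>" if "u \<in> {s..t}" "v \<in> {s..t}" for u v
    using geo I that unfolding geodesic_def by blast
  \<comment> \<open>The \<open>+ 1\<close> comes from the base case: \<open>dproj\<close> of a point
    with itself is the diameter of its projection, bounded by \<open>C\<close> but possibly
    nonzero.\<close>
  have chain: "dproj \<pi> (snd L u) (snd L t) \<le> C * (real n + 1)"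
    if "u \<in> {s..t}" "t - u \<le> real n * (2 * C)" for u n
    using that
  proof (induction n arbitrary: u)
    case 0
    then have "u = t" by simp
    then show ?case
      using contr[of "snd L t" "snd L t"] far[of t] \<open>s \<le> t\<close> \<open>C > 0\<close> by simp
  next
    case (Suc n)
    define v where "v = min t (u + 2 * C)"
    have v: "v \<in> {s..t}" "\<bar>u - v\<bar> \<le> 2 * C" "t - v \<le> real n * (2 * C)"
      using Suc.prems \<open>C > 0\<close> by (auto simp: v_def algebra_simps min_def)
    have "dproj \<pi> (snd L u) (snd L v) \<le> C"
      using contr g[of u v] far[of u] v Suc.prems \<open>C > 0\<close> by auto
    then have "dproj \<pi> (snd L u) (snd L t) \<le> C + C * (real n + 1)"
      using dproj_triangle[OF coarse, of "snd L u" "snd L t" "snd L v"] Suc.IH[OF v(1,3)]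
      by linarith
    then show ?case
      by (simp add: algebra_simps)
  qed
  define n where "n = nat \<lceil>(t - s) / (2 * C)\<rceil>"
  have n: "(t - s) / (2 * C) \<le> real n" "real n \<le> (t - s) / (2 * C) + 1"
    using of_nat_ceiling[of "(t - s) / (2 * C)"] divide_nonneg_pos[of "t - s" "2 * C"]
      \<open>s \<le> t\<close> \<open>C > 0\<close> by (auto simp: n_def)
  have "C * (real n + 1) \<le> C * ((t - s) / (2 * C) + 2)"
    using n(2) \<open>C > 0\<close> by (intro mult_left_mono) auto
  also have "\<dots> = (t - s) / 2 + 2 * C"
    using \<open>C > 0\<close> by (simp add: field_simps)
  finally show ?thesis
    using chain[of s n] n(1) \<open>s \<le> t\<close> \<open>C > 0\<close> by (simp add: divide_le_eq)
qed

text \<open>Write \<open>D\<close> for the quantity to bound and \<open>m = v - u\<close> for the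
  gap between the contracted balls, if there is one. Contraction gives
  \<open>D \<le> m / 2 + 4 * C\<close>, the detour through the projections gives
  \<open>m \<le> D + 8 * C\<close>, and together \<open>D \<le> 16 * C\<close>.\<close>

lemma dproj_le_of_far_segment:
  assumes coarse: "coarse_map \<pi> A" and "C \<ge> 1"
    and contr: "\<And>x y. dist x y < infdist x A - C \<Longrightarrow> dproj \<pi> x y \<le> C"
    and proj: "\<And>x. infdist x (\<pi> x) - infdist x A \<le> C"
    and geo: "geodesic L" and I: "{a..b} \<subseteq> fst L" and "a \<le> b"
    and far: "\<And>u. u \<in> {a..b} \<Longrightarrow> 4 * C \<le> infdist (snd L u) A"
  shows "dproj \<pi> (snd L a) (snd L b) \<le> 16 * C"
proof -
  have g: "dist (snd L u) (snd L v) = \<bar>u - v\<bar>" if "u \<in> {a..b}" "v \<in> {a..b}" for u v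
    using geo I that unfolding geodesic_def by blast
  let ?x = "snd L a" and ?y = "snd L b"
  \<comment> \<open>Contraction requires a distance strictly below \<open>infdist ?x A - C\<close>;
    the radius \<open>infdist ?x A - 2 * C\<close> meets this.\<close>
  define u where "u = a + (infdist ?x A - 2 * C)"
  define v where "v = b - (infdist ?y A - 2 * C)"
  have uv: "a \<le> u" "v \<le> b"
    using far[of a] far[of b] \<open>a \<le> b\<close> \<open>C \<ge> 1\<close> by (auto simp: u_def v_def)
  have cx: "dproj \<pi> ?x (snd L w) \<le> C" if "w \<in> {a..b}" "w \<le> u" for w
    using contr[of ?x "snd L w"] g[of a w] that \<open>a \<le> b\<close> \<open>C \<ge> 1\<close> by (auto simp: u_def)
  have cy: "dproj \<pi> (snd L w) ?y \<le> C" if "w \<in> {a..b}" "v \<le> w" for w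
    using contr[of ?y "snd L w"] g[of b w] that \<open>a \<le> b\<close> \<open>C \<ge> 1\<close>
    by (auto simp: v_def dproj_commute)
  consider "b \<le> u" | "v \<le> u" "u \<le> b" | "u < v"
    by linarith
  then show ?thesis
  proof cases
    case 1
    then show ?thesis
      using cx[of b] \<open>a \<le> b\<close> \<open>C \<ge> 1\<close> by auto
  next
    case 2
    then show ?thesis
      using cx[of u] cy[of u] dproj_triangle[OF coarse, of ?x ?y "snd L u"] uv \<open>C \<ge> 1\<close> by auto
  next
    case 3
    have "dproj \<pi> (snd L u) (snd L v) \<le> (v - u) / 2 + 2 * C"
      by (rule dproj_chain[OF coarse _ contr geo]) (use 3 uv I far \<open>C \<ge> 1\<close> in auto)
    then have le: "dproj \<pi> ?x ?y \<le> (v - u) / 2 + 4 * C"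
      using cx[of u] cy[of v] uv 3
        dproj_triangle[OF coarse, of ?x ?y "snd L u"]
        dproj_triangle[OF coarse, of "snd L u" ?y "snd L v"] by auto
    have near: "\<exists>p\<in>\<pi> x. dist x p < infdist x A + 2 * C" for x
    proof -
      have "infdist x (\<pi> x) < infdist x A + 2 * C"
        using proj[of x] \<open>C \<ge> 1\<close> by linarith
      then show ?thesis
        using infdist_ltE coarse_map_nonempty[OF coarse] by metis
    qed
    obtain p q where pq: "p \<in> \<pi> ?x" "dist ?x p < infdist ?x A + 2 * C"
        "q \<in> \<pi> ?y" "dist ?y q < infdist ?y A + 2 * C"
      using near by meson
    \<comment> \<open>The distances to \<open>A\<close> cancel against those in \<open>u\<close> and
      \<open>v\<close>; the excess \<open>8 * C\<close> is \<open>4 * C\<close> from the choice of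
      \<open>p\<close> and \<open>q\<close> and \<open>4 * C\<close> from the two radii.\<close>
    have "b - a = dist ?x ?y"
      using g[of a b] \<open>a \<le> b\<close> by simp
    also have "\<dots> \<le> dist ?x p + dist p q + dist ?y q"
      using dist_triangle[of ?x ?y p] dist_triangle[of p ?y q] by (simp add: dist_commute)
    also have "dist p q \<le> dproj \<pi> ?x ?y"
      using dist_le_dproj[OF coarse, of p ?x ?y q] pq by auto
    finally have "v - u \<le> 8 * C + dproj \<pi> ?x ?y"
      using pq by (simp add: u_def v_def)
    then show ?thesis
      using le by argo
  qed
qed

lemma strongly_contracting_imp_bounded_geodesic_image:
  assumes coarse: "coarse_map \<pi> A" and "strongly_contracting A \<pi>"
  shows "bounded_geodesic_image A \<pi>"
    and "bounded (range (\<lambda>x. infdist x (\<pi> x) - infdist x A))"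
proof -
  obtain C' where C': "\<And>x y. dist x y < infdist x A - C' \<Longrightarrow> dproj \<pi> x y \<le> C'"
      "\<And>x. infdist x (\<pi> x) - infdist x A \<le> C'"
    using assms(2) unfolding strongly_contracting_def by blast
  \<comment> \<open>The \<open>1\<close> makes the step length positive. Enlarging the constant
    strengthens the premise of the contraction property and weakens its conclusion.\<close>
  define C where "C = max 1 C'"
  have "C \<ge> 1" by (simp add: C_def)
  have contr: "dproj \<pi> x y \<le> C" if "dist x y < infdist x A - C" for x y
    using C'(1)[of x y] that unfolding C_def by linarith
  have proj: "infdist x (\<pi> x) - infdist x A \<le> C" for x
    using C'(2)[of x] by (simp add: C_def)
  have "0 \<le> infdist x (\<pi> x) - infdist x A" for x
    using infdist_mono[of "\<pi> x" A x] coarse_map_subset[OF coarse] coarse_map_nonempty[OF coarse]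
    by simp
  then show "bounded (range (\<lambda>x. infdist x (\<pi> x) - infdist x A))"
    using proj by (intro boundedI[of _ C]) auto
  show "bounded_geodesic_image A \<pi>"
    unfolding bounded_geodesic_image_def
  proof (intro exI allI impI)
    fix L :: "'a rpath"
    \<comment> \<open>One constant must serve as radius and as diameter bound, hence the radius
      \<open>16 * C\<close>.\<close>
    assume L: "geodesic L" "trace L \<inter> open_nbhd (16 * C) A = {}"
    have far: "4 * C \<le> infdist (snd L u) A" if "u \<in> fst L" for u
    proof -
      have "\<not> infdist (snd L u) A < 16 * C"
        using L(2) that unfolding trace_def open_nbhd_def by blast
      then show ?thesis
        using \<open>C \<ge> 1\<close> by simp
    qed
    have I: "is_interval (fst L)" "fst L \<noteq> {}"
      using L(1) by (auto simp: geodesic_def)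
    have sub: "{a..b} \<subseteq> fst L" if "a \<in> fst L" "b \<in> fst L" for a b
      using I(1) that by (meson atLeastAtMost_iff is_interval_1 subsetI)
    \<comment> \<open>\<open>L\<close> may be infinite; each pair of its points is joined by a
      compact segment, and the bound does not depend on its length.\<close>
    have le: "dproj \<pi> (snd L a) (snd L b) \<le> 16 * C" if "a \<in> fst L" "b \<in> fst L" "a \<le> b" for a b
    proof (rule dproj_le_of_far_segment[OF coarse \<open>C \<ge> 1\<close> contr proj L(1) sub[OF that(1,2)] that(3)])
      show "4 * C \<le> infdist (snd L u) A" if "u \<in> {a..b}" for u
        using far sub \<open>a \<in> fst L\<close> \<open>b \<in> fst L\<close> that by blast
    qed
    show "diam_le (\<Union>x\<in>trace L. \<pi> x) (16 * C)"
    proof (rule diam_leI)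
      show "(\<Union>x\<in>trace L. \<pi> x) \<noteq> {}"
        using I(2) coarse_map_nonempty[OF coarse] by (auto simp: trace_def)
    next
      fix p q assume "p \<in> (\<Union>x\<in>trace L. \<pi> x)" "q \<in> (\<Union>x\<in>trace L. \<pi> x)"
      then obtain a b where ab: "a \<in> fst L" "b \<in> fst L" "p \<in> \<pi> (snd L a)" "q \<in> \<pi> (snd L b)"
        by (auto simp: trace_def)
      then have "dist p q \<le> dproj \<pi> (snd L a) (snd L b)"
        using dist_le_dproj[OF coarse] by blast
      also have "\<dots> \<le> 16 * C"
        using le[of a b] le[of b a] ab by (cases "a \<le> b") (auto simp: dproj_commute)
      finally show "dist p q \<le> 16 * C" .
    qed
  qed
qed

section \<open>Bounded geodesic images imply strong constriction\<close>

text \<open>The near parameters between \<open>e\<close> and \<open>t1\<close> form a nonempty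
  compact set, and \<open>t\<close> is one closest to \<open>e\<close>. A
  \<open>closed_segment\<close> allows \<open>t1\<close> on either side of \<open>e\<close>.\<close>

lemma closed_segment_first_near:
  fixes e t1 :: real
  assumes geo: "geodesic P" and I: "e \<in> fst P" "t1 \<in> fst P" and t1: "infdist (snd P t1) A \<le> C"
  obtains t where "t \<in> fst P" "closed_segment e t \<subseteq> fst P" "infdist (snd P t) A \<le> C"
    "\<And>s. s \<in> closed_segment e t \<Longrightarrow> s \<noteq> t \<Longrightarrow> C < infdist (snd P s) A"
proof -
  have int: "is_interval (fst P)"
    and g: "\<And>s t. s \<in> fst P \<Longrightarrow> t \<in> fst P \<Longrightarrow> dist (snd P s) (snd P t) = \<bar>s - t\<bar>"
    using geo by (auto simp: geodesic_def)
  have seg: "closed_segment a b \<subseteq> fst P" if "a \<in> fst P" "b \<in> fst P" for a b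
    using int that by (simp add: closed_segment_subset is_interval_convex)
  \<comment> \<open>The parametrization is isometric and \<open>infdist\<close> is
    1-Lipschitz.\<close>
  have cont: "continuous_on (closed_segment e t1) (\<lambda>t. infdist (snd P t) A)"
    unfolding continuous_on_iff
  proof (intro ballI allI impI)
    fix x d :: real assume x: "x \<in> closed_segment e t1" and "0 < d"
    have "dist (infdist (snd P y) A) (infdist (snd P x) A) < d"
      if "y \<in> closed_segment e t1" "dist y x < d" for y
    proof -
      have "dist (snd P y) (snd P x) = dist y x"
        using g that(1) x seg[OF I] unfolding dist_real_def by blast
      then show ?thesis
        using infdist_triangle_abs[of "snd P y" A "snd P x"] that(2)
        unfolding dist_real_def by linarith
    qed
    then show "\<exists>d'>0. \<forall>y\<in>closed_segment e t1. dist y x < d' \<longrightarrow>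
        dist (infdist (snd P y) A) (infdist (snd P x) A) < d"
      using \<open>0 < d\<close> by blast
  qed
  let ?T = "{t \<in> closed_segment e t1. infdist (snd P t) A \<le> C}"
  have "closed ?T"
    using continuous_closed_preimage[OF cont closed_segment closed_atMost[of C]]
    by (simp add: vimage_def Int_def)
  then have "compact ({t. t \<in> closed_segment e t1} \<inter> ?T)"
    by (intro compact_Int_closed) auto
  moreover have "{t. t \<in> closed_segment e t1} \<inter> ?T = ?T" by auto
  ultimately have "compact ?T" by simp
  moreover have "t1 \<in> ?T" using t1 by auto
  ultimately obtain t where t: "t \<in> ?T" "\<And>s. s \<in> ?T \<Longrightarrow> dist e t \<le> dist e s"
    using distance_attains_inf[of ?T e] compact_imp_closed by blast
  have "C < infdist (snd P s) A" if s: "s \<in> closed_segment e t" "s \<noteq> t" for s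
  proof (rule ccontr)
    assume "\<not> ?thesis"
    then have "s \<in> ?T"
      using s t(1) subset_closed_segment[of e t e t1] by auto
    then have "dist e t \<le> dist e s"
      by (rule t(2))
    then show False
      using s by (auto simp: dist_real_def closed_segment_eq_real_ivl split: if_splits)
  qed
  moreover have "t \<in> fst P"
    using t(1) seg[OF I] by auto
  ultimately show thesis
    using that[of t] t(1) seg[OF I(1)] by auto
qed

text \<open>Let \<open>t\<close> be the first near parameter seen from \<open>e\<close>. If
  \<open>e \<noteq> t\<close>, the piece in between avoids the open neighborhood, so its projection
  has diameter at most \<open>C\<close>. At \<open>t\<close> the geodesic is within
  \<open>C + C\<close> of its own projection, up to \<open>\<epsilon>\<close>; this adds up to
  \<open>3 * C\<close>.\<close>

lemma setdist_proj_endpoint_le: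
  assumes coarse: "coarse_map \<pi> A" and C: "C \<ge> 0"
    and bgi: "\<And>L. geodesic L \<Longrightarrow> trace L \<inter> open_nbhd C A = {} \<Longrightarrow> diam_le (\<Union>x\<in>trace L. \<pi> x) C"
    and proj: "\<And>x. infdist x (\<pi> x) - infdist x A \<le> C"
    and geo: "geodesic P" and e: "e \<in> fst P"
    and meets: "trace P \<inter> open_nbhd C A \<noteq> {}"
  shows "setdist (\<pi> (snd P e)) (trace P) \<le> 3 * C"
proof -
  obtain t1 where t1: "t1 \<in> fst P" "infdist (snd P t1) A < C"
    using meets by (auto simp: trace_def open_nbhd_def)
  obtain t where t: "t \<in> fst P" "closed_segment e t \<subseteq> fst P" "infdist (snd P t) A \<le> C"
      "\<And>s. s \<in> closed_segment e t \<Longrightarrow> s \<noteq> t \<Longrightarrow> C < infdist (snd P s) A"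
    using closed_segment_first_near[OF geo e t1(1) less_imp_le[OF t1(2)]] by blast
  have diam: "diam_le (\<Union>x\<in>snd P ` closed_segment e t. \<pi> x) C" if "C \<le> infdist (snd P t) A"
  proof -
    let ?L = "(closed_segment e t, snd P)"
    have "geodesic ?L"
      using geo t(2) unfolding geodesic_def by (auto simp: is_interval_convex_1)
    moreover have "C \<le> infdist (snd P s) A" if "s \<in> closed_segment e t" for s
      using t(4)[of s] that \<open>C \<le> infdist (snd P t) A\<close> by (cases "s = t") auto
    then have "trace ?L \<inter> open_nbhd C A = {}"
      by (force simp: trace_def open_nbhd_def)
    ultimately show ?thesis
      using bgi[of ?L] by (simp add: trace_def)
  qed
  have near: "infdist (snd P t) (\<pi> (snd P t)) \<le> infdist (snd P t) A + C"
    using proj[of "snd P t"] by simp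
  have "\<exists>y\<in>\<pi> (snd P e). dist y (snd P t) < 3 * C + \<epsilon>" if "\<epsilon> > 0" for \<epsilon>
  proof -
    have "infdist (snd P t) (\<pi> (snd P t)) < 2 * C + \<epsilon>"
      using near t(3) that by linarith
    then obtain q where q: "q \<in> \<pi> (snd P t)" "dist (snd P t) q < 2 * C + \<epsilon>"
      using infdist_ltE coarse_map_nonempty[OF coarse] by metis
    show ?thesis
    proof (cases "e = t")
      case True
      then show ?thesis
        using q C by (auto simp: dist_commute intro!: bexI[of _ q])
    next
      case False
      have far: "C \<le> infdist (snd P t) A"
      proof (rule field_le_epsilon)
        fix d :: real assume "d > 0"
        \<comment> \<open>Approach \<open>t\<close> from the side of \<open>e\<close> without
          passing \<open>e\<close>: there the distance to \<open>A\<close> exceeds \<open>C\<close>,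
          and it changes by at most \<open>d\<close> up to \<open>t\<close>.\<close>
        define s where "s = (if e < t then max e (t - d) else min e (t + d))"
        have s: "s \<in> closed_segment e t" "s \<noteq> t" "\<bar>s - t\<bar> \<le> d"
          using False \<open>d > 0\<close> by (auto simp: s_def closed_segment_eq_real_ivl)
        have "dist (snd P s) (snd P t) = \<bar>s - t\<bar>"
          using geo t(1,2) s(1) unfolding geodesic_def by blast
        then show "C \<le> infdist (snd P t) A + d"
          using t(4)[OF s(1,2)] infdist_triangle[of "snd P s" A "snd P t"] s(3) by linarith
      qed
      obtain y where y: "y \<in> \<pi> (snd P e)"
        using coarse_map_nonempty[OF coarse] by blast
      have "dist y q \<le> C"
        by (rule dist_le_diam_le[OF diam[OF far]]) (use y q in auto)
      then show ?thesis
        using y q dist_triangle[of y "snd P t" q]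
        by (auto simp: dist_commute intro!: bexI[of _ y])
    qed
  qed
  then have "setdist (\<pi> (snd P e)) (trace P) \<le> 3 * C + \<epsilon>" if "\<epsilon> > 0" for \<epsilon>
    using setdist_le_dist[of _ "\<pi> (snd P e)" "snd P t" "trace P"] t(1) that
    unfolding trace_def by (meson imageI less_imp_le order_trans)
  then show ?thesis
    by (rule field_le_epsilon)
qed

lemma bounded_geodesic_image_imp_strongly_constricting:
  fixes A :: "'a::metric_space set"
  assumes geodesic_space: "\<And>x y :: 'a. \<exists>P. geodesic P \<and> has_endpoints P x y"
    and coarse: "coarse_map \<pi> A"
    and "bounded_geodesic_image A \<pi>"
    and "bounded (range (\<lambda>x. infdist x (\<pi> x) - infdist x A))"
  shows "strongly_constricting A \<pi>"
proof -
  obtain C1 where C1: "\<And>L. geodesic L \<Longrightarrow> trace L \<inter> open_nbhd C1 A = {} \<Longrightarrow>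
      diam_le (\<Union>x\<in>trace L. \<pi> x) C1"
    using assms(3) unfolding bounded_geodesic_image_def by blast
  obtain C2 where "\<And>x. \<bar>infdist x (\<pi> x) - infdist x A\<bar> \<le> C2"
    using assms(4) unfolding bounded_iff by auto
  then have C2: "infdist x (\<pi> x) - infdist x A \<le> C2" for x
    by (meson abs_le_D1)
  obtain C3 where C3: "C3 \<ge> 0" "\<And>x. diam_le (\<pi> x) C3"
    using coarse unfolding coarse_map_def C_coarse_map_def by blast
  \<comment> \<open>\<open>C3\<close> makes the maximum nonnegative and bounds the diameter of each
    projection.\<close>
  define C where "C = max C1 (max C2 C3)"
  have "C \<ge> 0" "C1 \<le> C" "C2 \<le> C" "C3 \<le> C"
    using C3 by (auto simp: C_def)
  have proj: "infdist x (\<pi> x) - infdist x A \<le> C" for x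
    using C2[of x] \<open>C2 \<le> C\<close> by linarith
  have bgi: "diam_le (\<Union>x\<in>trace L. \<pi> x) C" if "geodesic L" "trace L \<inter> open_nbhd C A = {}" for L
  proof -
    have "open_nbhd C1 A \<subseteq> open_nbhd C A"
      using \<open>C1 \<le> C\<close> by (auto simp: open_nbhd_def)
    then have "diam_le (\<Union>x\<in>trace L. \<pi> x) C1"
      using C1 that by blast
    then show ?thesis
      using \<open>C1 \<le> C\<close> by (simp add: diam_le_def)
  qed
  have equiv: "coarsely_equivalent_on (3 * C) A \<pi> (\<lambda>x. {x})"
    unfolding coarsely_equivalent_on_def
  proof (intro ballI conjI)
    fix x assume "x \<in> A"
    then have x: "infdist x (\<pi> x) \<le> C"
      using proj[of x] by simp
    then show "{x} \<subseteq> closed_nbhd (3 * C) (\<pi> x)"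
      using \<open>C \<ge> 0\<close> by (simp add: closed_nbhd_def)
    \<comment> \<open>One \<open>C\<close> reaches a point of \<open>\<pi> x\<close> from
      \<open>x\<close>, the other is the diameter of \<open>\<pi> x\<close>.\<close>
    have "dist y x \<le> 2 * C" if "y \<in> \<pi> x" for y
    proof (rule field_le_epsilon)
      fix d :: real assume "d > 0"
      then have "infdist x (\<pi> x) < C + d"
        using x by linarith
      then obtain z where z: "z \<in> \<pi> x" "dist x z < C + d"
        using infdist_ltE coarse_map_nonempty[OF coarse] by metis
      have "dist y z \<le> C"
        using dist_le_diam_le[OF C3(2) that z(1)] \<open>C3 \<le> C\<close> by linarith
      then show "dist y x \<le> 2 * C + d"
        using z dist_triangle[of y x z] by (simp add: dist_commute)
    qed
    then show "\<pi> x \<subseteq> closed_nbhd (3 * C) {x}"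
      using \<open>C \<ge> 0\<close> by (force simp: closed_nbhd_def)
  qed
  have "setdist (\<pi> x0) (trace P) \<le> 3 * C \<and> setdist (\<pi> x1) (trace P) \<le> 3 * C"
    if P: "geodesic P" "has_endpoints P x0 x1" and big: "dproj \<pi> x0 x1 > 3 * C" for P x0 x1
  proof -
    obtain e0 e1 where e: "e0 \<in> fst P" "e1 \<in> fst P" "x0 = snd P e0" "x1 = snd P e1"
      using P(2) unfolding has_endpoints_def by (auto simp: doubleton_eq_iff)
    \<comment> \<open>Otherwise the bounded image of the whole of \<open>P\<close> contains both
      endpoint projections, contradicting \<open>big\<close>.\<close>
    have "trace P \<inter> open_nbhd C A \<noteq> {}"
    proof
      assume "trace P \<inter> open_nbhd C A = {}"
      then have D: "diam_le (\<Union>x\<in>trace P. \<pi> x) C"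
        using bgi P(1) by blast
      have "dproj \<pi> x0 x1 \<le> C"
        by (rule dproj_leI[OF coarse], rule dist_le_diam_le[OF D]) (use e in \<open>auto simp: trace_def\<close>)
      then show False
        using big \<open>C \<ge> 0\<close> by linarith
    qed
    then show ?thesis
      using setdist_proj_endpoint_le[OF coarse \<open>C \<ge> 0\<close> bgi proj P(1)] e by blast
  qed
  then have "MC_constricting 1 (3 * C) {P. geodesic P} A \<pi>"
    unfolding MC_constricting_def
    using equiv contains_path_system_geodesics[OF geodesic_space] \<open>C \<ge> 0\<close> by auto
  then show ?thesis
    unfolding strongly_constricting_def by blast
qed

theorem proposition2p9:
  fixes A :: "'a::metric_space set" and \<pi> :: "'a \<Rightarrow> 'a set"
  assumes proper: "\<And>(x::'a) r. compact (cball x r)"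
    and geodesic_space: "\<And>x y :: 'a. \<exists>P. geodesic P \<and> has_endpoints P x y"
    and nonempty: "A \<noteq> {}"
    and coarse: "coarse_map \<pi> A"
  shows "(strongly_constricting A \<pi> \<longleftrightarrow>
            (\<exists>PS. path_system PS \<and> minimizing PS \<and> constricting PS A \<pi>)) \<and>
         (strongly_constricting A \<pi> \<longleftrightarrow> strongly_contracting A \<pi>) \<and>
         (strongly_constricting A \<pi> \<longleftrightarrow>
            bounded_geodesic_image A \<pi> \<and>
            bounded (range (\<lambda>x. infdist x (\<pi> x) - infdist x A)))"
proof -
  have "strongly_constricting A \<pi> \<Longrightarrow> \<exists>PS. path_system PS \<and> minimizing PS \<and> constricting PS A \<pi>"
    by (rule strongly_constricting_imp_minimizing[OF geodesic_space])
  moreover have "strongly_contracting A \<pi>"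
    if "\<exists>PS. path_system PS \<and> minimizing PS \<and> constricting PS A \<pi>"
    using that minimizing_constricting_imp_strongly_contracting[OF coarse nonempty] by blast
  moreover have "strongly_contracting A \<pi> \<Longrightarrow> bounded_geodesic_image A \<pi> \<and>
      bounded (range (\<lambda>x. infdist x (\<pi> x) - infdist x A))"
    using strongly_contracting_imp_bounded_geodesic_image[OF coarse] by simp
  moreover have "strongly_constricting A \<pi>"
    if "bounded_geodesic_image A \<pi> \<and> bounded (range (\<lambda>x. infdist x (\<pi> x) - infdist x A))"
    using that bounded_geodesic_image_imp_strongly_constricting[OF geodesic_space coarse] by simp
  ultimately show ?thesis
    by argo
qed

end
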